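(* Let $F,G:\mathbb R^4\to\mathbb R$ be a pair of differentiable functions and suppose that $M\subset\mathbb R^4$ is a surface defined as the transversal intersection $M=F^{-1}(a)\cap G^{-1}(b)$ of the inverse images of regular values $a$ of $F$ and $b$ of $G$. Let $\nu$ and $\mu$ be the gradient vector fields of $F$ and $G$, respectively. Then the differential equation of the $\nu$-lines of curvature of $M$ is $$\left(dx_1,\ dx_2,\ dx_3,\ dx_4\right)\begin{pmatrix}\Omega_{11}&\Omega_{12}&\Omega_{13}&\Omega_{14}\\ \Omega_{12}&\Omega_{22}&\Omega_{23}&\Omega_{24}\\ \Omega_{13}&\Omega_{23}&\Omega_{33}&\Omega_{34}\\ \Omega_{14}&\Omega_{24}&\Omega_{34}&\Omega_{44}\end{pmatrix}\begin{pmatrix} dx_1 \\ dx_2 \\ dx_3 \\ dx_4 \end{pmatrix}=0,$$ where $(x_1,x_2,x_3,x_4)$ are the coordinates of $\mathbb R^4$ and $$\Omega_{ij}=\frac12\left(\Big\langle \bar\nabla_{\frac{\partial}{\partial x_i}}\nu\wedge\frac{\partial}{\partial x_j}\wedge\mu,\ \nu\Big\rangle+\Big\langle \bar\nabla_{\frac{\partial}{\partial x_j}}\nu\wedge\frac{\partial}{\partial x_i}\wedge\mu,\ \nu\Big\rangle\right).$$ That is, for $p\in M$, a vector $X=(dx_1,dx_2,dx_3,dx_4)\in T_pM$ is tangent to a $\nu$-principal direction at $p$ if and only if it satisfies this equation at $p$.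
   Context: "Differentiable" means smooth. $\bar\nabla$ is the Riemannian connection (directional derivative) of $\mathbb R^4$, and for $a,b,c\in\mathbb R^4$, $a\wedge b\wedge c\in\mathbb R^4$ is the triple vector product, so that $\langle a\wedge b\wedge c,d\rangle=\det(a,b,c,d)$ (up to a universal sign). For a unit normal field $\tilde\nu$ on a surface $M\subset\mathbb R^4$, the $\tilde\nu$-shape operator is $S_{\tilde\nu}(X)=-(\bar\nabla_X\tilde\nu)^\top$ on $T_pM$ ($\top$ = tangential component); a vector $X\in T_pM$ is tangent to a $\tilde\nu$-principal direction if $S_{\tilde\nu}(X)=\lambda X$ for some $\lambda\in\mathbb R$, and the $\tilde\nu$-lines of curvature are the integral curves of these directions. For a nowhere zero, not necessarily unit normal field $\nu$, the $\nu$-principal directions and $\nu$-lines of curvature are those of $\tilde\nu=\nu/\|\nu\|$. *)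

theory Defs
  imports "HOL-Analysis.Analysis"
begin

(* Class C^k, for functions on an open set S: in the step, all directional derivatives
   are required to be of class C^k again. *)
fun Ck_on :: "nat \<Rightarrow> ('a::real_normed_vector \<Rightarrow> 'b::real_normed_vector) \<Rightarrow> 'a set \<Rightarrow> bool" where
  "Ck_on 0 f S \<longleftrightarrow> continuous_on S f"
| "Ck_on (Suc k) f S \<longleftrightarrow>
     (\<forall>x\<in>S. f differentiable (at x)) \<and> (\<forall>v. Ck_on k (\<lambda>x. frechet_derivative f (at x) v) S)"

definition smooth_on :: "('a::real_normed_vector \<Rightarrow> 'b::real_normed_vector) \<Rightarrow> 'a set \<Rightarrow> bool" where
  "smooth_on f S \<longleftrightarrow> (\<forall>k. Ck_on k f S)"

definition regular_value ::
    "('a::real_normed_vector \<Rightarrow> 'b::real_normed_vector) \<Rightarrow> 'b \<Rightarrow> bool" where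
  "regular_value f c \<longleftrightarrow> (\<forall>x. f x = c \<longrightarrow> surj (frechet_derivative f (at x)))"

(* Velocities at p of smooth curves lying in S; this is the usual tangent space when S is an
   embedded submanifold, and the definition makes sense for an arbitrary set S. *)
definition tangent_space :: "'a::real_normed_vector set \<Rightarrow> 'a \<Rightarrow> 'a set" where
  "tangent_space S p =
     {v. \<exists>\<epsilon>>0. \<exists>\<gamma> :: real \<Rightarrow> 'a. smooth_on \<gamma> {-\<epsilon><..<\<epsilon>} \<and> \<gamma> ` {-\<epsilon><..<\<epsilon>} \<subseteq> S \<and>
        \<gamma> 0 = p \<and> (\<gamma> has_vector_derivative v) (at 0)}"

definition transversal :: "'a::real_normed_vector set \<Rightarrow> 'a set \<Rightarrow> bool" where
  "transversal A B \<longleftrightarrow>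
     (\<forall>p \<in> A \<inter> B. {u + v |u v. u \<in> tangent_space A p \<and> v \<in> tangent_space B p} = UNIV)"

definition tangential_component :: "'a::real_inner set \<Rightarrow> 'a \<Rightarrow> 'a \<Rightarrow> 'a" where
  "tangential_component M p w =
     (THE u. u \<in> tangent_space M p \<and> (\<forall>t \<in> tangent_space M p. orthogonal (w - u) t))"

(* The Riemannian connection of Euclidean space at the point p: the directional derivative of
   the vector field V at p in the direction X. *)
definition connection :: "'a::real_normed_vector \<Rightarrow> 'a \<Rightarrow> ('a \<Rightarrow> 'a) \<Rightarrow> 'a" where
  "connection p X V = frechet_derivative V (at p) X"

(* The normal field n is given on a neighbourhood of p in the ambient space. For X tangent to M
   its derivative in the direction X depends only on the restriction of n to M. *)
definition shape_operator :: "'a::real_inner set \<Rightarrow> ('a \<Rightarrow> 'a) \<Rightarrow> 'a \<Rightarrow> 'a \<Rightarrow> 'a" where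
  "shape_operator M n p X = - tangential_component M p (connection p X n)"

(* For a normal field \<nu> that is nonzero on M but not necessarily of unit length. *)
definition tangent_to_principal_direction ::
    "'a::real_inner set \<Rightarrow> ('a \<Rightarrow> 'a) \<Rightarrow> 'a \<Rightarrow> 'a \<Rightarrow> bool" where
  "tangent_to_principal_direction M \<nu> p X \<longleftrightarrow>
     X \<in> tangent_space M p \<and>
     (\<exists>l. shape_operator M (\<lambda>x. \<nu> x /\<^sub>R norm (\<nu> x)) p X = l *\<^sub>R X)"

definition wedge3 :: "real^4 \<Rightarrow> real^4 \<Rightarrow> real^4 \<Rightarrow> real^4" where
  "wedge3 x y z = (\<chi> i. det (vector [x, y, z, axis i 1] :: real^4^4))"

lemma inner_wedge3: "wedge3 x y z \<bullet> w = det (vector [x, y, z, w] :: real^4^4)"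
proof -
  define L where "L v = (\<chi> i::4. if i = 4 then v else (vector [x, y, z, w] :: real^4^4) $ i)" for v
  have L: "(vector [x, y, z, v] :: real^4^4) = L v" for v
    by (simp add: L_def vec_eq_iff forall_4 vector_def)
  have "det (L w) = det (L (\<Sum>i\<in>UNIV. w $ i *s axis i 1))"
    by (simp add: basis_expansion)
  also have "\<dots> = (\<Sum>i\<in>UNIV. det (L (w $ i *s axis i 1)))"
    unfolding L_def by (rule det_linear_row_sum) simp
  also have "\<dots> = (\<Sum>i\<in>UNIV. w $ i * det (L (axis i 1)))"
    unfolding L_def det_row_mul ..
  finally show ?thesis
    by (simp add: L wedge3_def inner_vec_def mult.commute)
qed

definition Omega :: "(real^4 \<Rightarrow> real^4) \<Rightarrow> (real^4 \<Rightarrow> real^4) \<Rightarrow> real^4 \<Rightarrow> real^4^4" where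
  "Omega \<nu> \<mu> p = (\<chi> i j. 1/2 *
     (wedge3 (connection p (axis i 1) \<nu>) (axis j 1) (\<mu> p) \<bullet> \<nu> p +
      wedge3 (connection p (axis j 1) \<nu>) (axis i 1) (\<mu> p) \<bullet> \<nu> p))"

end

theory Submission
  imports Defs
begin

text \<open>For \<open>X \<noteq> 0\<close> in \<open>T\<^sub>pM = {\<nu>, \<mu>}\<^sup>\<bottom>\<close>, the vector \<open>q = X \<and> \<mu> \<and> \<nu>\<close> is nonzero, and
  \<open>X, q\<close> is an orthogonal basis of \<open>T\<^sub>pM\<close>. Hence \<open>X\<close> is principal iff the derivative of the unit
  normal in the direction \<open>X\<close> is orthogonal to \<open>q\<close>. Normalising \<open>\<nu>\<close> changes its derivative by a
  nonzero factor and a multiple of \<open>\<nu>\<close>, so this says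
  \<open>\<langle>\<nabla>\<^sub>X\<nu> \<and> X \<and> \<mu>, \<nu>\<rangle> = 0\<close>, and the left-hand side is the quadratic form of \<open>\<Omega>\<close>.
  The tangent space is defined by smooth curves, so that it is all of \<open>{\<nu>, \<mu>}\<^sup>\<bottom>\<close> needs
  the inverse function theorem together with a proof that the curves it provides are smooth.\<close>

section \<open>Smooth maps\<close>

text \<open>\<open>frechet_derivative\<close> is chosen by its defining property at a point, which
  depends only on values near that point. As \<open>S\<close> is open, the derivatives of
  \<open>f\<close> and \<open>g\<close> agree on \<open>S\<close> too, and the induction continues
  with them.\<close>

lemma Ck_on_cong:
  assumes "open S" and "\<And>x. x \<in> S \<Longrightarrow> f x = g x"
  shows "Ck_on k f S \<longleftrightarrow> Ck_on k g S"
  using assms(2)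
proof (induction k arbitrary: f g)
  case 0
  then show ?case by (simp cong: continuous_on_cong)
next
  case (Suc k)
  have D: "(f has_derivative D) (at x) \<longleftrightarrow> (g has_derivative D) (at x)" if "x \<in> S" for x D
    using has_derivative_transform_within_open[OF _ \<open>open S\<close> that, of f D _ g]
      has_derivative_transform_within_open[OF _ \<open>open S\<close> that, of g D _ f] Suc.prems by auto
  have *: "frechet_derivative f (at x) = frechet_derivative g (at x)" if "x \<in> S" for x
    using D[OF that] by (simp add: frechet_derivative_def)
  have "Ck_on k (\<lambda>x. frechet_derivative f (at x) v) S = Ck_on k (\<lambda>x. frechet_derivative g (at x) v) S" for v
    by (rule Suc.IH) (simp add: *)
  then show ?case using D by (auto simp: differentiable_def)
qed

text \<open>This lets inductions on the class use an explicit derivative formula, valid on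
  \<open>S\<close>, in place of the chosen \<open>frechet_derivative\<close>.\<close>

lemma Ck_on_SucI:
  assumes "open S" and "\<And>x. x \<in> S \<Longrightarrow> (f has_derivative f' x) (at x)"
    and "\<And>v. Ck_on k (\<lambda>x. f' x v) S"
  shows "Ck_on (Suc k) f S"
proof -
  have "frechet_derivative f (at x) = f' x" if "x \<in> S" for x
    using frechet_derivative_at[OF assms(2)[OF that]] by simp
  then have "Ck_on k (\<lambda>x. frechet_derivative f (at x) v) S" for v
    using Ck_on_cong[OF \<open>open S\<close>, of "\<lambda>x. frechet_derivative f (at x) v" "\<lambda>x. f' x v" k] assms(3) by auto
  then show ?thesis using assms(2) by (auto simp: differentiable_def)
qed

lemma Ck_on_Suc_imp_has_derivative:
  assumes "Ck_on (Suc k) f S"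
  shows "\<exists>f'. (\<forall>x\<in>S. (f has_derivative f' x) (at x)) \<and> (\<forall>v. Ck_on k (\<lambda>x. f' x v) S)"
  using assms
  by (intro exI[of _ "\<lambda>x. frechet_derivative f (at x)"]) (auto simp: frechet_derivative_works)

lemma Ck_on_SucD: "Ck_on (Suc k) f S \<Longrightarrow> Ck_on k f S"
proof (induction k arbitrary: f)
  case 0
  then show ?case
    by (simp add: continuous_at_imp_continuous_on differentiable_imp_continuous_within)
qed auto

lemma Ck_on_const: "Ck_on k (\<lambda>x. c) S"
  by (induction k arbitrary: c) (auto simp: frechet_derivative_const)

lemma Ck_on_bounded_linear_compose:
  assumes "bounded_linear L" and "open S" and "Ck_on k f S"
  shows "Ck_on k (\<lambda>x. L (f x)) S"
  using assms(3)
proof (induction k arbitrary: f)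
  case 0
  then show ?case by (simp add: bounded_linear.continuous_on[OF assms(1)])
next
  case (Suc k)
  obtain f' where f': "\<And>x. x \<in> S \<Longrightarrow> (f has_derivative f' x) (at x)"
    and "\<And>v. Ck_on k (\<lambda>x. f' x v) S" using Ck_on_Suc_imp_has_derivative[OF Suc.prems] by blast
  then show ?case
    by (intro Ck_on_SucI[OF \<open>open S\<close>, where f' = "\<lambda>x v. L (f' x v)"] Suc.IH
        bounded_linear.has_derivative[OF assms(1)])
qed

lemma Ck_on_add:
  assumes "open S" and "Ck_on k f S" and "Ck_on k g S"
  shows "Ck_on k (\<lambda>x. f x + g x) S"
  using assms(2,3)
proof (induction k arbitrary: f g)
  case 0
  then show ?case by (simp add: continuous_on_add)
next
  case (Suc k)
  obtain f' where f': "\<And>x. x \<in> S \<Longrightarrow> (f has_derivative f' x) (at x)"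
    and "\<And>v. Ck_on k (\<lambda>x. f' x v) S" using Ck_on_Suc_imp_has_derivative[OF Suc.prems(1)] by blast
  moreover obtain g' where g': "\<And>x. x \<in> S \<Longrightarrow> (g has_derivative g' x) (at x)"
    and "\<And>v. Ck_on k (\<lambda>x. g' x v) S" using Ck_on_Suc_imp_has_derivative[OF Suc.prems(2)] by blast
  ultimately show ?case
    by (intro Ck_on_SucI[OF \<open>open S\<close>, where f' = "\<lambda>x v. f' x v + g' x v"] Suc.IH
        has_derivative_add)
qed

text \<open>Each term of the product rule keeps one factor undifferentiated.
  \<open>Ck_on_SucD\<close> lowers the class of that factor by one, so that the induction hypothesis
  applies.\<close>

lemma Ck_on_bounded_bilinear:
  assumes "bounded_bilinear B" and "open S" and "Ck_on k f S" and "Ck_on k g S"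
  shows "Ck_on k (\<lambda>x. B (f x) (g x)) S"
  using assms(3,4)
proof (induction k arbitrary: f g)
  case 0
  then show ?case by (simp add: bounded_bilinear.continuous_on[OF assms(1)])
next
  case (Suc k)
  obtain f' where f': "\<And>x. x \<in> S \<Longrightarrow> (f has_derivative f' x) (at x)"
    and "\<And>v. Ck_on k (\<lambda>x. f' x v) S" using Ck_on_Suc_imp_has_derivative[OF Suc.prems(1)] by blast
  moreover obtain g' where g': "\<And>x. x \<in> S \<Longrightarrow> (g has_derivative g' x) (at x)"
    and "\<And>v. Ck_on k (\<lambda>x. g' x v) S" using Ck_on_Suc_imp_has_derivative[OF Suc.prems(2)] by blast
  ultimately show ?case
    by (intro Ck_on_SucI[OF \<open>open S\<close>, where f' = "\<lambda>x v. B (f x) (g' x v) + B (f' x v) (g x)"]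
        Ck_on_add[OF \<open>open S\<close>] Suc.IH bounded_bilinear.FDERIV[OF assms(1)] Suc.prems[THEN Ck_on_SucD])
qed

text \<open>The derivative formula contains the reciprocal itself, but only its class
  \<open>k\<close> is needed there, which is the induction hypothesis.\<close>

lemma Ck_on_inverse:
  fixes f :: "'a::real_normed_vector \<Rightarrow> real"
  assumes "open S" and "Ck_on k f S" and "\<And>x. x \<in> S \<Longrightarrow> f x \<noteq> 0"
  shows "Ck_on k (\<lambda>x. inverse (f x)) S"
  using assms(2)
proof (induction k)
  case 0
  then show ?case using assms(3) by (simp add: continuous_on_inverse)
next
  case (Suc k)
  obtain f' where f': "\<And>x. x \<in> S \<Longrightarrow> (f has_derivative f' x) (at x)"
    and f'_Ck: "\<And>v. Ck_on k (\<lambda>x. f' x v) S" using Ck_on_Suc_imp_has_derivative[OF Suc.prems] by blast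
  have inv: "Ck_on k (\<lambda>x. inverse (f x)) S"
    using Suc Ck_on_SucD by blast
  show ?case
  proof (rule Ck_on_SucI[OF \<open>open S\<close>])
    show "((\<lambda>x. inverse (f x)) has_derivative (\<lambda>h. - (inverse (f x) * f' x h * inverse (f x)))) (at x)"
      if "x \<in> S" for x
      using assms(3) f' that by (intro Deriv.has_derivative_inverse) auto
    show "Ck_on k (\<lambda>x. - (inverse (f x) * f' x v * inverse (f x))) S" for v
      by (intro Ck_on_bounded_linear_compose[OF bounded_linear_minus[OF bounded_linear_ident]]
          Ck_on_bounded_bilinear[OF bounded_bilinear_mult] \<open>open S\<close> inv f'_Ck)
  qed
qed

section \<open>Closure properties of smooth functions\<close>

lemma smooth_on_continuous_on: "smooth_on f S \<Longrightarrow> continuous_on S f"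
  by (metis Ck_on.simps(1) smooth_on_def)

lemma smooth_on_differentiable: "smooth_on f S \<Longrightarrow> x \<in> S \<Longrightarrow> f differentiable (at x)"
  by (metis Ck_on.simps(2) smooth_on_def)

lemma smooth_on_frechet_derivative:
  "smooth_on f S \<Longrightarrow> smooth_on (\<lambda>x. frechet_derivative f (at x) v) S"
  by (metis Ck_on.simps(2) smooth_on_def)

lemma smooth_on_const: "smooth_on (\<lambda>x. c) S"
  by (simp add: smooth_on_def Ck_on_const)

lemma smooth_on_add:
  "open S \<Longrightarrow> smooth_on f S \<Longrightarrow> smooth_on g S \<Longrightarrow> smooth_on (\<lambda>x. f x + g x) S"
  by (simp add: smooth_on_def Ck_on_add)

lemma smooth_on_sum:
  assumes "open S" and "\<And>i. i \<in> I \<Longrightarrow> smooth_on (f i) S"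
  shows "smooth_on (\<lambda>x. \<Sum>i\<in>I. f i x) S"
  using assms(2)
  by (induction I rule: infinite_finite_induct) (auto intro!: smooth_on_add smooth_on_const assms(1))

lemma smooth_on_bounded_linear_compose:
  "bounded_linear L \<Longrightarrow> open S \<Longrightarrow> smooth_on f S \<Longrightarrow> smooth_on (\<lambda>x. L (f x)) S"
  by (simp add: smooth_on_def Ck_on_bounded_linear_compose)

lemma smooth_on_bounded_bilinear:
  "bounded_bilinear B \<Longrightarrow> open S \<Longrightarrow> smooth_on f S \<Longrightarrow> smooth_on g S \<Longrightarrow>
    smooth_on (\<lambda>x. B (f x) (g x)) S"
  by (simp add: smooth_on_def Ck_on_bounded_bilinear)

lemmas smooth_on_mult =
  smooth_on_bounded_bilinear[OF bounded_bilinear_mult]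
lemmas smooth_on_scaleR = smooth_on_bounded_bilinear[OF bounded_bilinear_scaleR]
lemmas smooth_on_inner_left = smooth_on_bounded_linear_compose[OF bounded_linear_inner_left]

lemma smooth_on_inverse:
  fixes f :: "'a::real_normed_vector \<Rightarrow> real"
  shows "open S \<Longrightarrow> smooth_on f S \<Longrightarrow> (\<And>x. x \<in> S \<Longrightarrow> f x \<noteq> 0) \<Longrightarrow>
    smooth_on (\<lambda>x. inverse (f x)) S"
  by (simp add: smooth_on_def Ck_on_inverse)

lemma smooth_on_subset: "smooth_on f S \<Longrightarrow> T \<subseteq> S \<Longrightarrow> smooth_on f T"
proof -
  have "Ck_on k f T" if "Ck_on k f S" "T \<subseteq> S" for k
    using that by (induction k arbitrary: f) (auto intro: continuous_on_subset)
  then show "smooth_on f S \<Longrightarrow> T \<subseteq> S \<Longrightarrow> smooth_on f T" by (simp add: smooth_on_def)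
qed

section \<open>Derivatives along vector fields and integral curves\<close>

text \<open>\<open>smooth_on_frechet_derivative\<close> treats a fixed direction. Linearity of the
  derivative expands the varying direction \<open>V x\<close> into the fixed ones of
  \<open>Basis\<close>, with smooth coefficients.\<close>

lemma smooth_on_derivative_along:
  fixes f :: "'a::euclidean_space \<Rightarrow> 'b::real_normed_vector"
  assumes "open U" and f: "smooth_on f U" and "smooth_on V U"
  shows "smooth_on (\<lambda>x. frechet_derivative f (at x) (V x)) U"
proof -
  have "smooth_on (\<lambda>x. \<Sum>i\<in>Basis. (V x \<bullet> i) *\<^sub>R frechet_derivative f (at x) i) U"
    by (intro smooth_on_sum smooth_on_scaleR smooth_on_inner_left smooth_on_frechet_derivative assms)
  moreover have "(\<Sum>i\<in>Basis. (V x \<bullet> i) *\<^sub>R frechet_derivative f (at x) i)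
      = frechet_derivative f (at x) (V x)" if "x \<in> U" for x
  proof -
    have "linear (frechet_derivative f (at x))"
      using smooth_on_differentiable[OF f that] linear_frechet_derivative by blast
    then have "(\<Sum>i\<in>Basis. (V x \<bullet> i) *\<^sub>R frechet_derivative f (at x) i)
        = frechet_derivative f (at x) (\<Sum>i\<in>Basis. (V x \<bullet> i) *\<^sub>R i)"
      by (simp add: linear_sum linear_scale)
    then show ?thesis by (simp add: euclidean_representation)
  qed
  ultimately show ?thesis
    unfolding smooth_on_def
    by (subst Ck_on_cong[OF \<open>open U\<close>, of _
          "\<lambda>x. \<Sum>i\<in>Basis. (V x \<bullet> i) *\<^sub>R frechet_derivative f (at x) i"]) auto
qed

text \<open>If \<open>\<gamma>' = V \<circ> \<gamma>\<close>, then the derivative of \<open>f \<circ> \<gamma>\<close> is \<open>Df V \<circ> \<gamma>\<close>, so composing with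
  \<open>\<gamma>\<close> gains one derivative at a time.\<close>

lemma Ck_on_compose_integral_curve:
  fixes f :: "'a::euclidean_space \<Rightarrow> 'b::real_normed_vector" and \<gamma> :: "real \<Rightarrow> 'a"
  assumes "open I" and "open U" and V: "smooth_on V U" and "\<gamma> ` I \<subseteq> U"
    and \<gamma>: "\<And>t. t \<in> I \<Longrightarrow> (\<gamma> has_vector_derivative V (\<gamma> t)) (at t)"
    and "smooth_on f U"
  shows "Ck_on k (\<lambda>t. f (\<gamma> t)) I"
  using assms(6)
proof (induction k arbitrary: f)
  case 0
  have "continuous_on I \<gamma>"
    using \<gamma> by (meson continuous_at_imp_continuous_on has_vector_derivative_continuous)
  then show ?case
    using continuous_on_compose2[OF smooth_on_continuous_on[OF 0] _ assms(4)] by simp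
next
  case (Suc k)
  show ?case
  proof (rule Ck_on_SucI[OF \<open>open I\<close>])
    fix t assume t: "t \<in> I"
    have "(f has_derivative frechet_derivative f (at (\<gamma> t))) (at (\<gamma> t))"
      using smooth_on_differentiable[OF Suc.prems] assms(4) t frechet_derivative_works by blast
    with \<gamma>[OF t] have "((\<lambda>t. f (\<gamma> t)) has_derivative
        (\<lambda>s. frechet_derivative f (at (\<gamma> t)) (s *\<^sub>R V (\<gamma> t)))) (at t)"
      unfolding has_vector_derivative_def by (rule has_derivative_compose)
    moreover have "linear (frechet_derivative f (at (\<gamma> t)))"
      using smooth_on_differentiable[OF Suc.prems] assms(4) t linear_frechet_derivative by blast
    ultimately show "((\<lambda>t. f (\<gamma> t)) has_derivative
        (\<lambda>s. s *\<^sub>R frechet_derivative f (at (\<gamma> t)) (V (\<gamma> t)))) (at t)"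
      by (simp add: linear_scale)
  next
    \<comment> \<open>In direction \<open>s\<close> the derivative is \<open>s\<close> times the
      velocity, and the velocity is again a smooth function on \<open>U\<close> composed with
      \<open>\<gamma>\<close>.\<close>
    fix s :: real
    show "Ck_on k (\<lambda>t. s *\<^sub>R frechet_derivative f (at (\<gamma> t)) (V (\<gamma> t))) I"
      by (intro Ck_on_bounded_linear_compose[OF bounded_linear_scaleR_right] \<open>open I\<close>
          Suc.IH smooth_on_derivative_along[OF \<open>open U\<close> Suc.prems V])
  qed
qed

lemma smooth_on_ident: "open S \<Longrightarrow> smooth_on (\<lambda>x. x) S"
proof -
  assume "open S"
  have "Ck_on k (\<lambda>x. x) S" for k
  proof (cases k)
    case (Suc k')
    show ?thesis unfolding Suc
      by (rule Ck_on_SucI[OF \<open>open S\<close> has_derivative_ident]) (rule Ck_on_const)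
  qed simp
  then show ?thesis by (simp add: smooth_on_def)
qed

text \<open>Of \<open>\<gamma>\<close> only the differential equation is assumed; composing the
  identity with \<open>\<gamma>\<close> passes the smoothness of \<open>V\<close> on to it.\<close>

lemma smooth_on_integral_curve:
  fixes \<gamma> :: "real \<Rightarrow> 'a::euclidean_space"
  assumes "open I" and "open U" and "smooth_on V U" and "\<gamma> ` I \<subseteq> U"
    and "\<And>t. t \<in> I \<Longrightarrow> (\<gamma> has_vector_derivative V (\<gamma> t)) (at t)"
  shows "smooth_on \<gamma> I"
  unfolding smooth_on_def
  using Ck_on_compose_integral_curve[OF assms smooth_on_ident[OF \<open>open U\<close>]] by blast

section \<open>Smoothness by coordinates and gradient fields\<close>

lemma sum_scaleR_axis: "(\<Sum>i\<in>UNIV. x $ i *\<^sub>R axis i 1) = (x::real^'n)"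
  using basis_expansion[of x] by (simp add: scalar_mult_eq_scaleR)

lemma smooth_on_vec:
  fixes f :: "'a::real_normed_vector \<Rightarrow> real^'n"
  assumes "open S" and "\<And>i. smooth_on (\<lambda>x. f x $ i) S"
  shows "smooth_on f S"
proof -
  have "smooth_on (\<lambda>x. \<Sum>i\<in>UNIV. f x $ i *\<^sub>R axis i (1::real)) S"
    by (intro smooth_on_sum smooth_on_scaleR smooth_on_const assms)
  then show ?thesis
    by (simp add: sum_scaleR_axis)
qed

text \<open>The coordinates of the gradient are the directional derivatives of \<open>F\<close>
  along the axes.\<close>

lemma smooth_on_gradient:
  fixes F :: "real^'n \<Rightarrow> real"
  assumes "open S" and "smooth_on F S" and "\<And>x. GDERIV F x :> n x"
  shows "smooth_on n S"
proof (rule smooth_on_vec[OF \<open>open S\<close>])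
  fix i
  have "(\<lambda>x. n x $ i) = (\<lambda>x. frechet_derivative F (at x) (axis i 1))"
    using frechet_derivative_at[OF assms(3)[unfolded gderiv_def]]
    by (metis (no_types) cart_eq_inner_axis inner_commute)
  then show "smooth_on (\<lambda>x. n x $ i) S"
    using smooth_on_frechet_derivative[OF assms(2)] by simp
qed

lemma smooth_on_nth: "open S \<Longrightarrow> smooth_on f S \<Longrightarrow> smooth_on (\<lambda>x. f x $ i) S"
  by (rule smooth_on_bounded_linear_compose[OF bounded_linear_vec_nth])

lemma smooth_on_uminus: "open S \<Longrightarrow> smooth_on f S \<Longrightarrow> smooth_on (\<lambda>x. - f x) S"
  by (rule smooth_on_bounded_linear_compose[OF bounded_linear_minus[OF bounded_linear_ident]])

lemma smooth_on_diff:
  "open S \<Longrightarrow> smooth_on f S \<Longrightarrow> smooth_on g S \<Longrightarrow> smooth_on (\<lambda>x. f x - g x) S"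
  using smooth_on_add[of S f "\<lambda>x. - g x"] smooth_on_uminus[of S g] by simp

section \<open>The triple vector product\<close>

text \<open>Laplace expansion along the first row; it reduces the identities for
  \<open>wedge3\<close> to polynomial ones.\<close>

lemma det_4:
  "det (A::'a::comm_ring_1^4^4) =
    A$1$1 * (A$2$2 * (A$3$3 * A$4$4 - A$3$4 * A$4$3) - A$2$3 * (A$3$2 * A$4$4 - A$3$4 * A$4$2)
      + A$2$4 * (A$3$2 * A$4$3 - A$3$3 * A$4$2)) -
    A$1$2 * (A$2$1 * (A$3$3 * A$4$4 - A$3$4 * A$4$3) - A$2$3 * (A$3$1 * A$4$4 - A$3$4 * A$4$1)
      + A$2$4 * (A$3$1 * A$4$3 - A$3$3 * A$4$1)) +
    A$1$3 * (A$2$1 * (A$3$2 * A$4$4 - A$3$4 * A$4$2) - A$2$2 * (A$3$1 * A$4$4 - A$3$4 * A$4$1)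
      + A$2$4 * (A$3$1 * A$4$2 - A$3$2 * A$4$1)) -
    A$1$4 * (A$2$1 * (A$3$2 * A$4$3 - A$3$3 * A$4$2) - A$2$2 * (A$3$1 * A$4$3 - A$3$3 * A$4$1)
      + A$2$3 * (A$3$1 * A$4$2 - A$3$2 * A$4$1))"
proof -
  \<comment> \<open>These facts let the sum over permutations be unfolded one index at a
    time.\<close>
  have "1 \<notin> {2::4, 3, 4}" "2 \<notin> {3::4, 4}" "3 \<notin> {4::4}"
    by auto
  then show ?thesis
    unfolding det_def UNIV_4
    by (simp add: sum_over_permutations_insert permutes_sing sign_swap_id sign_compose sign_id
        permutation_compose permutation_swap_id swap_id_eq algebra_simps)
qed

lemma vector_4:
  "(vector [x,y,z,w] :: 'a::zero^4) $ 1 = x" "(vector [x,y,z,w] :: 'a^4) $ 2 = y"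
  "(vector [x,y,z,w] :: 'a^4) $ 3 = z" "(vector [x,y,z,w] :: 'a^4) $ 4 = w"
  by (simp_all add: vector_def)

text \<open>These are the signed minors of the expansion along the last row, which is
  \<open>axis i 1\<close> in \<open>wedge3_def\<close>.\<close>

lemma wedge3_nth:
  "wedge3 x y z $ 1 = - det (vector [vector [x$2,x$3,x$4], vector [y$2,y$3,y$4], vector [z$2,z$3,z$4]] :: real^3^3)"
  "wedge3 x y z $ 2 = det (vector [vector [x$1,x$3,x$4], vector [y$1,y$3,y$4], vector [z$1,z$3,z$4]] :: real^3^3)"
  "wedge3 x y z $ 3 = - det (vector [vector [x$1,x$2,x$4], vector [y$1,y$2,y$4], vector [z$1,z$2,z$4]] :: real^3^3)"
  "wedge3 x y z $ 4 = det (vector [vector [x$1,x$2,x$3], vector [y$1,y$2,y$3], vector [z$1,z$2,z$3]] :: real^3^3)"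
  by (simp_all add: wedge3_def det_4 det_3 vector_4 vector_3 axis_def algebra_simps)

text \<open>Each is a determinant with two equal rows.\<close>

lemma wedge3_orthogonal [simp]:
  "wedge3 x y z \<bullet> x = 0" "wedge3 x y z \<bullet> y = 0" "wedge3 x y z \<bullet> z = 0"
  by (simp_all add: inner_wedge3 det_4 vector_4 algebra_simps)

text \<open>A cyclic shift of four rows is an odd permutation, hence the sign.\<close>

lemma wedge3_rotate: "wedge3 w x y \<bullet> z = - (wedge3 x y z \<bullet> w)"
  by (simp add: inner_wedge3 det_4 vector_4 algebra_simps)

lemma wedge3_swap: "wedge3 x y w \<bullet> z = - (wedge3 x y z \<bullet> w)"
  by (simp add: inner_wedge3 det_4 vector_4 algebra_simps)

lemma linear_wedge3:
  "linear (\<lambda>x. wedge3 x y z)" "linear (\<lambda>y. wedge3 x y z)"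
  by (rule linearI; simp add: vec_eq_iff forall_4 wedge3_nth det_3 vector_3 algebra_simps)+

text \<open>The matrix with rows \<open>x\<close>, \<open>y\<close>, \<open>z\<close>,
  \<open>w\<close> is invertible and maps \<open>h\<close> to zero.\<close>

lemma wedge3_inner_nonzeroD:
  assumes "wedge3 x y z \<bullet> w \<noteq> 0" and "h \<bullet> x = 0" "h \<bullet> y = 0" "h \<bullet> z = 0" "h \<bullet> w = 0"
  shows "h = 0"
proof -
  define A where "A = (vector [x, y, z, w] :: real^4^4)"
  have "A *v h = 0"
    using assms(2-5) by (simp add: A_def vec_eq_iff forall_4 matrix_vector_mult_def vector_4 inner_vec_def mult.commute)
  moreover have "invertible A"
    using assms(1) by (simp add: A_def inner_wedge3 invertible_det_nz)
  ultimately show ?thesis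
    unfolding invertible_left_inverse matrix_left_invertible_ker by blast
qed

text \<open>The vectors orthogonal to \<open>x\<close>, \<open>y\<close>, \<open>z\<close> form a
  line spanned by their triple product; pairing with \<open>w\<close> determines the
  coefficient.\<close>

lemma eq_scaleR_wedge3:
  assumes "wedge3 x y z \<bullet> w \<noteq> 0" and "h \<bullet> x = 0" "h \<bullet> y = 0" "h \<bullet> z = 0"
  shows "h = ((h \<bullet> w) / (wedge3 x y z \<bullet> w)) *\<^sub>R wedge3 x y z"
proof -
  have "h - ((h \<bullet> w) / (wedge3 x y z \<bullet> w)) *\<^sub>R wedge3 x y z = 0"
    by (rule wedge3_inner_nonzeroD[OF assms(1)]) (use assms in \<open>simp_all add: inner_diff_left\<close>)
  then show ?thesis by simp
qed

text \<open>A nonzero \<open>d\<close> orthogonal to \<open>x\<close>, \<open>y\<close>,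
  \<open>z\<close> completes them to a basis, so the determinant of the four rows does not
  vanish.\<close>

lemma wedge3_nonzero:
  assumes indep: "\<And>\<alpha> \<beta> \<gamma>. \<alpha> *\<^sub>R x + \<beta> *\<^sub>R y + \<gamma> *\<^sub>R z = 0 \<Longrightarrow>
    \<alpha> = 0 \<and> \<beta> = 0 \<and> \<gamma> = 0"
  shows "wedge3 x y z \<noteq> 0"
proof -
  have "dim {x, y, z} \<le> card {x, y, z}" by (rule dim_le_card') simp
  also have "\<dots> \<le> 3" by (simp add: card_insert_if)
  finally have "dim {x, y, z} < DIM(real^4)" by simp
  then obtain d where d: "d \<noteq> 0" and "\<And>v. v \<in> span {x, y, z} \<Longrightarrow> orthogonal d v"
    by (metis orthogonal_to_subspace_exists)
  then have orth: "d \<bullet> x = 0" "d \<bullet> y = 0" "d \<bullet> z = 0"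
    by (simp_all add: orthogonal_def span_base)
  define A where "A = (vector [x, y, z, d] :: real^4^4)"
  have "c i = 0" if "(\<Sum>i\<in>UNIV. c i *s row i A) = 0" for c i
  proof -
    have r: "c 1 *\<^sub>R x + c 2 *\<^sub>R y + c 3 *\<^sub>R z + c 4 *\<^sub>R d = 0"
      using that by (simp add: sum_4 A_def row_def vector_4 scalar_mult_eq_scaleR)
    then have "d \<bullet> (c 1 *\<^sub>R x + c 2 *\<^sub>R y + c 3 *\<^sub>R z + c 4 *\<^sub>R d) = 0" by simp
    then have "c 4 = 0" using d orth by (simp add: inner_add_right)
    with r indep[of "c 1" "c 2" "c 3"] have "c 1 = 0 \<and> c 2 = 0 \<and> c 3 = 0" by simp
    with \<open>c 4 = 0\<close> show ?thesis by (metis exhaust_4)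
  qed
  then have "invertible A"
    unfolding invertible_right_inverse matrix_right_invertible_independent_rows by blast
  then have "wedge3 x y z \<bullet> d \<noteq> 0"
    by (simp add: inner_wedge3 A_def invertible_det_nz)
  then show ?thesis by auto
qed

lemma smooth_on_wedge3:
  assumes "open S" and "smooth_on f S" and "smooth_on g S" and "smooth_on h S"
  shows "smooth_on (\<lambda>x. wedge3 (f x) (g x) (h x)) S"
proof (rule smooth_on_vec[OF \<open>open S\<close>])
  fix i :: 4
  have "i = 1 \<or> i = 2 \<or> i = 3 \<or> i = 4" using exhaust_4 .
  then show "smooth_on (\<lambda>x. wedge3 (f x) (g x) (h x) $ i) S"
    by (elim disjE; simp only: wedge3_nth det_3 vector_3)
      (intro smooth_on_uminus smooth_on_diff smooth_on_add smooth_on_mult smooth_on_nth assms)+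
qed

section \<open>Tangent spaces of level sets\<close>

lemma tangent_space_0: "p \<in> S \<Longrightarrow> 0 \<in> tangent_space S p"
  unfolding tangent_space_def
  by (auto intro!: exI[of _ "1::real"] exI[of _ "\<lambda>t. p"] simp: smooth_on_const)

text \<open>\<open>F\<close> is constant along a curve in its level set, so the chain rule gives
  zero.\<close>

lemma tangent_space_vimage_orthogonal:
  assumes "GDERIV F p :> n" and "v \<in> tangent_space (F -` {a}) p"
  shows "v \<bullet> n = 0"
proof -
  obtain \<epsilon> \<gamma> where "\<epsilon> > 0" and \<gamma>: "\<gamma> ` {-\<epsilon><..<\<epsilon>} \<subseteq> F -` {a}"
    "\<gamma> 0 = p" "(\<gamma> has_vector_derivative v) (at 0)"
    using assms(2) by (auto simp: tangent_space_def)
  have "(F has_derivative (\<lambda>h. h \<bullet> n)) (at (\<gamma> 0))"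
    using assms(1) \<gamma>(2) by (simp add: gderiv_def)
  from has_derivative_compose[OF \<gamma>(3)[unfolded has_vector_derivative_def] this]
  have "((\<lambda>t. F (\<gamma> t)) has_derivative (\<lambda>s. (s *\<^sub>R v) \<bullet> n)) (at 0)" .
  moreover have "((\<lambda>t. F (\<gamma> t)) has_derivative (\<lambda>s. 0)) (at 0)"
  proof (rule has_derivative_transform_within_open[OF has_derivative_const])
    show "a = F (\<gamma> t)" if "t \<in> {-\<epsilon><..<\<epsilon>}" for t
      using \<gamma>(1) that by (auto simp: image_subset_iff)
  qed (use \<open>\<epsilon> > 0\<close> in auto)
  ultimately have "(\<lambda>s. (s *\<^sub>R v) \<bullet> n) = (\<lambda>s. 0)"
    by (rule has_derivative_unique)
  from fun_cong[OF this, of 1] show ?thesis by simp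
qed

lemma tangent_space_mono: "S \<subseteq> T \<Longrightarrow> tangent_space S p \<subseteq> tangent_space T p"
  unfolding tangent_space_def by blast

lemma gradient_nonzero_at_regular_value:
  assumes "regular_value F a" and "F p = a" and "GDERIV F p :> n"
  shows "n \<noteq> 0"
proof
  assume "n = 0"
  then have "frechet_derivative F (at p) = (\<lambda>h. 0)"
    using frechet_derivative_at[OF assms(3)[unfolded gderiv_def]] by simp
  then have "surj (\<lambda>h::'a. 0::real)" using assms(1,2) unfolding regular_value_def by metis
  then show False by (metis surjE zero_neq_one)
qed

text \<open>Transversality splits \<open>n\<close> as \<open>u + v\<close> with \<open>u\<close>
  orthogonal to \<open>n\<close> and \<open>v\<close> orthogonal to \<open>m\<close>. A dependence
  would make \<open>v\<close> orthogonal to \<open>n\<close> as well, and then \<open>n\<close>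
  orthogonal to itself.\<close>

lemma transversal_gradients_independent:
  assumes "transversal (F -` {a}) (G -` {b})" and "F p = a" and "G p = b"
    and "GDERIV F p :> n" and "GDERIV G p :> m" and "n \<noteq> 0" and "m \<noteq> 0"
    and eq: "\<alpha> *\<^sub>R n + \<beta> *\<^sub>R m = 0"
  shows "\<alpha> = 0 \<and> \<beta> = 0"
proof (rule ccontr)
  assume "\<not> (\<alpha> = 0 \<and> \<beta> = 0)"
  with eq \<open>n \<noteq> 0\<close> \<open>m \<noteq> 0\<close> have "\<alpha> \<noteq> 0" by auto
  have "n \<in> {u + v |u v. u \<in> tangent_space (F -` {a}) p \<and> v \<in> tangent_space (G -` {b}) p}"
    using assms(1-3) unfolding transversal_def by blast
  then obtain u v where uv: "n = u + v" "u \<bullet> n = 0" "v \<bullet> m = 0"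
    using tangent_space_vimage_orthogonal assms(4,5) by blast
  have "v \<bullet> (\<alpha> *\<^sub>R n + \<beta> *\<^sub>R m) = 0" using eq by simp
  then have "v \<bullet> n = 0" using uv(3) \<open>\<alpha> \<noteq> 0\<close> by (simp add: inner_add_right)
  then have "n \<bullet> n = 0" using uv(1,2) by (metis add.right_neutral inner_add_left)
  then show False using \<open>n \<noteq> 0\<close> by simp
qed

text \<open>With \<open>z = wedge3 (\<nu> p) (\<mu> p) v\<close>, the inverse function theorem applied to
  \<open>x \<mapsto> (F x, G x, z \<bullet> x, v \<bullet> x)\<close> turns a straight line in the target into a curve in the
  intersection of the level sets. Its velocity is orthogonal to \<open>\<nu>\<close>, \<open>\<mu>\<close> and \<open>z\<close>, so it is a
  smooth function of the position and the curve is smooth.\<close>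

lemma tangent_space_level_sets:
  fixes F G :: "real^4 \<Rightarrow> real"
  assumes "smooth_on F UNIV" and "smooth_on G UNIV"
    and F: "\<And>x. GDERIV F x :> \<nu> x" and G: "\<And>x. GDERIV G x :> \<mu> x"
    and "F p = a" and "G p = b"
    and indep: "\<And>\<alpha> \<beta>. \<alpha> *\<^sub>R \<nu> p + \<beta> *\<^sub>R \<mu> p = 0 \<Longrightarrow> \<alpha> = 0 \<and> \<beta> = 0"
  shows "tangent_space (F -` {a} \<inter> G -` {b}) p = {v. v \<bullet> \<nu> p = 0 \<and> v \<bullet> \<mu> p = 0}" (is "?T = ?N")
proof
  show "?T \<subseteq> ?N"
  proof
    fix v assume "v \<in> ?T"
    then have "v \<in> tangent_space (F -` {a}) p" "v \<in> tangent_space (G -` {b}) p"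
      by (auto intro: tangent_space_mono[THEN subsetD, rotated])
    then show "v \<in> ?N"
      using tangent_space_vimage_orthogonal[OF F] tangent_space_vimage_orthogonal[OF G] by simp
  qed
  show "?N \<subseteq> ?T"
  proof
    fix v assume "v \<in> ?N"
    then have v: "v \<bullet> \<nu> p = 0" "v \<bullet> \<mu> p = 0" by auto
    show "v \<in> ?T"
    proof (cases "v = 0")
      case True
      then show ?thesis using assms(5,6) by (simp add: tangent_space_0)
    next
      case False
      define z where "z = wedge3 (\<nu> p) (\<mu> p) v"
      \<comment> \<open>This is the determinant of the derivative \<open>D x\<close> of the map
        \<open>\<Phi>\<close> below, so \<open>U\<close> is where that derivative is
        invertible.\<close>
      define \<Delta> where "\<Delta> x = wedge3 (\<nu> x) (\<mu> x) z \<bullet> v" for x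
      define U where "U = {x. \<Delta> x \<noteq> 0}"
      \<comment> \<open>For \<open>x\<close> in \<open>U\<close>, this is the only vector orthogonal
        to \<open>\<nu> x\<close>, \<open>\<mu> x\<close> and \<open>z\<close> whose inner product
        with \<open>v\<close> is \<open>v \<bullet> v\<close>. It will be the velocity field of the
        curve.\<close>
      define V where "V x = ((v \<bullet> v) * inverse (\<Delta> x)) *\<^sub>R wedge3 (\<nu> x) (\<mu> x) z" for x
      have "z \<noteq> 0"
        unfolding z_def
      proof (rule wedge3_nonzero)
        fix \<alpha> \<beta> \<gamma> assume eq: "\<alpha> *\<^sub>R \<nu> p + \<beta> *\<^sub>R \<mu> p + \<gamma> *\<^sub>R v = 0"
        then have "v \<bullet> (\<alpha> *\<^sub>R \<nu> p + \<beta> *\<^sub>R \<mu> p + \<gamma> *\<^sub>R v) = 0" by simp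
        then have "\<gamma> = 0" using v False by (simp add: inner_add_right)
        with eq indep[of \<alpha> \<beta>] show "\<alpha> = 0 \<and> \<beta> = 0 \<and> \<gamma> = 0" by simp
      qed
      have "\<Delta> p = - (z \<bullet> z)"
        unfolding \<Delta>_def by (subst wedge3_swap) (simp add: z_def)
      then have "p \<in> U" using \<open>z \<noteq> 0\<close> by (simp add: U_def)
      have sm: "smooth_on \<nu> UNIV" "smooth_on \<mu> UNIV"
        using smooth_on_gradient[OF open_UNIV assms(1) F] smooth_on_gradient[OF open_UNIV assms(2) G]
        by auto
      have \<Delta>: "smooth_on \<Delta> UNIV"
        unfolding \<Delta>_def by (intro smooth_on_inner_left smooth_on_wedge3 sm smooth_on_const open_UNIV)
      have "open U"
        unfolding U_def using smooth_on_continuous_on[OF \<Delta>]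
        by (intro open_Collect_neq) auto
      have V: "smooth_on V U"
        unfolding V_def using smooth_on_subset[OF sm(1)] smooth_on_subset[OF sm(2)] smooth_on_subset[OF \<Delta>]
        by (intro smooth_on_scaleR smooth_on_mult smooth_on_wedge3 smooth_on_const smooth_on_inverse
            \<open>open U\<close>) (auto simp: U_def)

      define \<Phi> :: "real^4 \<Rightarrow> real^4" where
        "\<Phi> x = F x *\<^sub>R axis 1 1 + G x *\<^sub>R axis 2 1
          + (x \<bullet> z) *\<^sub>R axis 3 1 + (x \<bullet> v) *\<^sub>R axis 4 1" for x
      define D :: "real^4 \<Rightarrow> real^4 \<Rightarrow> real^4" where
        "D x h = (h \<bullet> \<nu> x) *\<^sub>R axis 1 1 + (h \<bullet> \<mu> x) *\<^sub>R axis 2 1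
          + (h \<bullet> z) *\<^sub>R axis 3 1 + (h \<bullet> v) *\<^sub>R axis 4 1" for x h
      have \<Phi>_nth: "\<Phi> x $ 1 = F x" "\<Phi> x $ 2 = G x" "\<Phi> x $ 3 = x \<bullet> z" "\<Phi> x $ 4 = x \<bullet> v" for x
        by (simp_all add: \<Phi>_def axis_def)
      have D_nth: "D x h $ 1 = h \<bullet> \<nu> x" "D x h $ 2 = h \<bullet> \<mu> x" "D x h $ 3 = h \<bullet> z" "D x h $ 4 = h \<bullet> v"
        for x h by (simp_all add: D_def axis_def)
      have \<Phi>_deriv: "(\<Phi> has_derivative D x) (at x)" for x
        unfolding \<Phi>_def D_def
        by (auto intro!: derivative_eq_intros F[unfolded gderiv_def] G[unfolded gderiv_def])
      then have D_bl: "bounded_linear (D x)" for x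
        by (rule has_derivative_bounded_linear)
      \<comment> \<open>The inverse function theorem wants continuity in operator norm; in finite
        dimension it suffices to check it on each fixed vector.\<close>
      have D_cont: "continuous_on U (\<lambda>x. Blinfun (D x))"
      proof (rule continuous_on_blinfun_componentwise)
        fix i :: "real^4"
        have "continuous_on U \<nu>" "continuous_on U \<mu>"
          using sm[THEN smooth_on_continuous_on] continuous_on_subset by blast+
        then show "continuous_on U (\<lambda>x. blinfun_apply (Blinfun (D x)) i)"
          unfolding bounded_linear_Blinfun_apply[OF D_bl] D_def by (intro continuous_intros)
      qed
      have "inj (D p)"
        unfolding linear_injective_0[OF bounded_linear.linear[OF D_bl]]
      proof (intro allI impI)
        fix h assume "D p h = 0"
        then have "h \<bullet> \<nu> p = 0" "h \<bullet> \<mu> p = 0" "h \<bullet> z = 0" "h \<bullet> v = 0"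
          using D_nth[of p h] by simp_all
        then show "h = 0"
          using wedge3_inner_nonzeroD \<open>p \<in> U\<close> unfolding U_def \<Delta>_def by blast
      qed
      then obtain E where "linear E" and E: "E \<circ> D p = id"
        using linear_injective_left_inverse bounded_linear.linear[OF D_bl] by blast
      then have "bounded_linear E" by (simp add: linear_conv_bounded_linear)
      then have "Blinfun E o\<^sub>L Blinfun (D p) = id_blinfun"
        using fun_cong[OF E] by (intro blinfun_eqI) (simp add: bounded_linear_Blinfun_apply D_bl)
      moreover have "(\<Phi> has_derivative blinfun_apply (Blinfun (D x))) (at x)" for x
        by (simp add: bounded_linear_Blinfun_apply D_bl \<Phi>_deriv)
      ultimately obtain U' W g g' where "U' \<subseteq> U" "p \<in> U'" "open W" "\<Phi> p \<in> W"
        and hom: "homeomorphism U' W \<Phi> g" and g': "\<And>y. y \<in> W \<Longrightarrow> (g has_derivative (g' y)) (at y)"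
        using inverse_function_theorem[OF \<open>open U\<close> _ D_cont \<open>p \<in> U\<close>] by metis

      \<comment> \<open>The line moves only the fourth coordinate, so \<open>F\<close> and
        \<open>G\<close> stay constant on its preimage. The speed \<open>v \<bullet> v\<close> is
        the rate at which \<open>x \<bullet> v\<close> grows when the velocity is
        \<open>v\<close>.\<close>
      define l where "l t = \<Phi> p + t *\<^sub>R axis 4 (v \<bullet> v)" for t
      define \<gamma> where "\<gamma> t = g (l t)" for t
      have "open (l -` W)"
        unfolding l_def using \<open>open W\<close> by (intro open_vimage continuous_intros)
      moreover have "0 \<in> l -` W" using \<open>\<Phi> p \<in> W\<close> by (simp add: l_def)
      ultimately obtain \<epsilon> where "\<epsilon> > 0" and ball: "ball 0 \<epsilon> \<subseteq> l -` W"
        by (meson open_contains_ball)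
      define I where "I = {-\<epsilon><..<\<epsilon>}"
      have "open I" "0 \<in> I" using \<open>\<epsilon> > 0\<close> by (auto simp: I_def)
      have l: "l t \<in> W" if "t \<in> I" for t
        using that ball by (auto simp: I_def dist_real_def subset_iff)
      have \<gamma>_U: "\<gamma> ` I \<subseteq> U"
        using l homeomorphism_image2[OF hom] \<open>U' \<subseteq> U\<close> by (auto simp: \<gamma>_def)
      have \<Phi>_\<gamma>: "\<Phi> (\<gamma> t) = l t" if "t \<in> I" for t
        using homeomorphism_apply2[OF hom l[OF that]] by (simp add: \<gamma>_def)
      have "\<gamma> 0 = p"
        using homeomorphism_apply1[OF hom \<open>p \<in> U'\<close>] by (simp add: \<gamma>_def l_def)
      have \<gamma>_deriv: "(\<gamma> has_vector_derivative V (\<gamma> t)) (at t)" if t: "t \<in> I" for t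
      proof -
        have l_deriv: "(l has_derivative (\<lambda>s. s *\<^sub>R axis 4 (v \<bullet> v))) (at t)"
          unfolding l_def by (auto intro!: derivative_eq_intros)
        then have \<gamma>': "(\<gamma> has_derivative (\<lambda>s. g' (l t) (s *\<^sub>R axis 4 (v \<bullet> v)))) (at t)"
          unfolding \<gamma>_def using g'[OF l[OF t]] by (rule has_derivative_compose)
        define d where "d = g' (l t) (axis 4 (v \<bullet> v))"
        have \<gamma>_d: "(\<gamma> has_vector_derivative d) (at t)"
          using \<gamma>' linear_scale[OF has_derivative_linear[OF g'[OF l[OF t]]]]
          by (simp add: has_vector_derivative_def d_def)
        \<comment> \<open>Differentiating \<open>\<Phi> (\<gamma> t) = l t\<close> in two ways gives
          the four inner products that determine \<open>d\<close>.\<close>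
        have "((\<lambda>t. \<Phi> (\<gamma> t)) has_derivative (\<lambda>s. D (\<gamma> t) (s *\<^sub>R d))) (at t)"
          using \<gamma>_d \<Phi>_deriv unfolding has_vector_derivative_def by (rule has_derivative_compose)
        then have "(l has_derivative (\<lambda>s. D (\<gamma> t) (s *\<^sub>R d))) (at t)"
          by (rule has_derivative_transform_within_open[OF _ \<open>open I\<close> t]) (simp add: \<Phi>_\<gamma>)
        then have "(\<lambda>s. D (\<gamma> t) (s *\<^sub>R d)) = (\<lambda>s. s *\<^sub>R axis 4 (v \<bullet> v))"
          using l_deriv by (rule has_derivative_unique)
        from fun_cong[OF this, of 1] have "D (\<gamma> t) d = axis 4 (v \<bullet> v)" by simp
        then have d: "d \<bullet> \<nu> (\<gamma> t) = 0" "d \<bullet> \<mu> (\<gamma> t) = 0" "d \<bullet> z = 0" "d \<bullet> v = v \<bullet> v"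
          using D_nth[of "\<gamma> t" d] by (simp_all add: axis_def)
        have "\<Delta> (\<gamma> t) \<noteq> 0" using \<gamma>_U t by (auto simp: U_def)
        then have "d = V (\<gamma> t)"
          using eq_scaleR_wedge3[OF _ d(1-3), of v] d(4)
          by (simp add: V_def \<Delta>_def divide_inverse)
        then show ?thesis using \<gamma>_d by simp
      qed
      \<comment> \<open>At \<open>p\<close> the vector \<open>v\<close> meets the conditions that
        characterise \<open>V p\<close>: it is normal to both gradients, and to \<open>z\<close>
        because \<open>z\<close> is a triple product with factor \<open>v\<close>.\<close>
      have "V p = v"
      proof -
        have "wedge3 (\<nu> p) (\<mu> p) z \<bullet> v \<noteq> 0" using \<open>p \<in> U\<close> by (simp add: U_def \<Delta>_def)
        moreover have "v \<bullet> z = 0" by (simp add: z_def inner_commute[of v])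
        ultimately show ?thesis
          using eq_scaleR_wedge3[OF _ v, of z v] by (simp add: V_def \<Delta>_def divide_inverse)
      qed
      then have "(\<gamma> has_vector_derivative v) (at 0)"
        using \<gamma>_deriv[OF \<open>0 \<in> I\<close>] \<open>\<gamma> 0 = p\<close> by simp
      moreover have "smooth_on \<gamma> I"
        using \<open>open I\<close> \<open>open U\<close> V \<gamma>_U \<gamma>_deriv by (rule smooth_on_integral_curve)
      moreover have "\<gamma> ` I \<subseteq> F -` {a} \<inter> G -` {b}"
      proof clarify
        fix t assume "t \<in> I"
        then have "\<Phi> (\<gamma> t) = l t" by (rule \<Phi>_\<gamma>)
        then have "\<Phi> (\<gamma> t) $ 1 = \<Phi> p $ 1" "\<Phi> (\<gamma> t) $ 2 = \<Phi> p $ 2"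
          by (simp_all add: l_def axis_def)
        then show "\<gamma> t \<in> F -` {a} \<inter> G -` {b}" using assms(5,6) by (simp add: \<Phi>_nth)
      qed
      ultimately show ?thesis
        using \<open>\<epsilon> > 0\<close> \<open>\<gamma> 0 = p\<close> unfolding tangent_space_def I_def by blast
    qed
  qed
qed

section \<open>Principal directions\<close>

text \<open>By the product rule, differentiating the factor \<open>inverse (norm (n x))\<close>
  contributes only a multiple of \<open>n p\<close>, which is orthogonal to
  \<open>q\<close>.\<close>

lemma frechet_derivative_normalize_inner:
  fixes n :: "'a::euclidean_space \<Rightarrow> 'b::euclidean_space"
  assumes "n differentiable (at p)" and "n p \<noteq> 0" and "q \<bullet> n p = 0"
  shows "frechet_derivative (\<lambda>x. n x /\<^sub>R norm (n x)) (at p) X \<bullet> q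
    = (frechet_derivative n (at p) X \<bullet> q) / norm (n p)"
proof -
  have "(\<lambda>x. inverse (norm (n x))) differentiable (at p)"
    using assms(1,2) by (intro differentiable_inverse differentiable_compose[of norm n])
      (simp_all add: differentiable_norm_at)
  then obtain f' where f': "((\<lambda>x. inverse (norm (n x))) has_derivative f') (at p)"
    unfolding differentiable_def by blast
  have "((\<lambda>x. n x /\<^sub>R norm (n x)) has_derivative
      (\<lambda>h. inverse (norm (n p)) *\<^sub>R frechet_derivative n (at p) h + f' h *\<^sub>R n p)) (at p)"
    using f' assms(1)[unfolded frechet_derivative_works] by (rule has_derivative_scaleR)
  from frechet_derivative_at[OF this, symmetric] show ?thesis
    using assms(3) by (simp add: inner_add_left inner_commute[of "n p"] divide_inverse)
qed

text \<open>Orthogonal projection onto a subspace is unique: the difference of two candidates is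
  tangent and orthogonal to itself. This resolves the definite description.\<close>

lemma tangential_component_eqI:
  assumes "subspace (tangent_space M p)" and "u \<in> tangent_space M p"
    and "\<And>t. t \<in> tangent_space M p \<Longrightarrow> (w - u) \<bullet> t = 0"
  shows "tangential_component M p w = u"
  unfolding tangential_component_def
proof (rule the_equality)
  fix u' assume u': "u' \<in> tangent_space M p \<and> (\<forall>t\<in>tangent_space M p. orthogonal (w - u') t)"
  then have "u' - u \<in> tangent_space M p" using assms(1,2) by (simp add: subspace_diff)
  with u' assms(3) have "(w - u') \<bullet> (u' - u) = 0" "(w - u) \<bullet> (u' - u) = 0"
    by (auto simp: orthogonal_def)
  then have "(u' - u) \<bullet> (u' - u) = 0" by (simp add: inner_diff_left)
  then show "u' = u" by simp
qed (use assms in \<open>auto simp: orthogonal_def\<close>)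

text \<open>\<open>Omega\<close> is the matrix of the symmetric part of the bilinear form
  \<open>B\<close> below, and symmetrising does not change the quadratic form.\<close>

lemma Omega_quadratic_form:
  assumes "\<nu> differentiable (at p)"
  shows "(X v* Omega \<nu> \<mu> p) \<bullet> X = wedge3 (connection p X \<nu>) X (\<mu> p) \<bullet> \<nu> p"
proof -
  define B where "B x y = wedge3 (connection p x \<nu>) y (\<mu> p) \<bullet> \<nu> p" for x y
  have "linear (\<lambda>x. wedge3 (connection p x \<nu>) y (\<mu> p))" for y
    using linear_compose[OF linear_frechet_derivative[OF assms] linear_wedge3(1)]
    by (simp add: o_def connection_def)
  then have "linear (\<lambda>x. B x y)" "linear (B x)" for x y
    using linear_compose[OF _ bounded_linear.linear[OF bounded_linear_inner_left], of _ "\<nu> p"]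
      linear_wedge3(2) unfolding B_def by (auto simp: o_def)
  note B_linear = this
  have X: "X = (\<Sum>i\<in>UNIV. X $ i *\<^sub>R axis i 1)"
    by (rule sum_scaleR_axis[symmetric])
  have "B X X = (\<Sum>i\<in>UNIV. X $ i * B (axis i 1) X)"
    by (subst (1) X) (simp add: linear_sum[OF B_linear(1)] linear_scale[OF B_linear(1)])
  also have "\<dots> = (\<Sum>i\<in>UNIV. X $ i * (\<Sum>j\<in>UNIV. X $ j * B (axis i 1) (axis j 1)))"
    by (subst (2) X) (simp add: linear_sum[OF B_linear(2)] linear_scale[OF B_linear(2)])
  finally have B: "B X X = (\<Sum>i\<in>UNIV. \<Sum>j\<in>UNIV. X $ i * X $ j * B (axis i 1) (axis j 1))"
    by (simp add: sum_distrib_left mult.assoc)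
  have Omega_nth: "Omega \<nu> \<mu> p $ i $ j = 1/2 * (B (axis i 1) (axis j 1) + B (axis j 1) (axis i 1))" for i j
    by (simp add: Omega_def B_def)
  have "(X v* Omega \<nu> \<mu> p) $ j = (\<Sum>i\<in>UNIV.
      1/2 * (X $ i * (B (axis i 1) (axis j 1) + B (axis j 1) (axis i 1))))" for j
    by (simp add: vector_matrix_mult_def Omega_nth mult_ac)
  moreover have "(X v* Omega \<nu> \<mu> p) \<bullet> X = (\<Sum>j\<in>UNIV. (X v* Omega \<nu> \<mu> p) $ j * X $ j)"
    by (simp add: inner_vec_def)
  ultimately have "(X v* Omega \<nu> \<mu> p) \<bullet> X = (\<Sum>j\<in>UNIV. \<Sum>i\<in>UNIV.
      1/2 * (X $ i * X $ j * B (axis i 1) (axis j 1)) + 1/2 * (X $ j * X $ i * B (axis j 1) (axis i 1)))"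
    by (simp add: sum_distrib_left sum_distrib_right algebra_simps)
  also have "\<dots> = 1/2 * (\<Sum>j\<in>UNIV. \<Sum>i\<in>UNIV. X $ i * X $ j * B (axis i 1) (axis j 1)) + 1/2 * B X X"
    by (simp only: sum.distrib sum_distrib_left B)
  \<comment> \<open>Both halves of the symmetrised sum equal \<open>B X X\<close>, up to the order
    of summation.\<close>
  also have "(\<Sum>j\<in>UNIV. \<Sum>i\<in>UNIV. X $ i * X $ j * B (axis i 1) (axis j 1)) = B X X"
    unfolding B by (rule sum.swap)
  finally show ?thesis by (simp add: B_def)
qed

text \<open>This is linear algebra at one point: \<open>M\<close> enters only through its tangent
  plane at \<open>p\<close>, and \<open>m\<close> stands for the value of the second normal field
  there.\<close>

lemma tangent_to_principal_direction_iff: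
  fixes M :: "(real^4) set"
  assumes T: "tangent_space M p = {v. v \<bullet> \<nu> p = 0 \<and> v \<bullet> m = 0}"
    and indep: "\<And>\<alpha> \<beta>. \<alpha> *\<^sub>R \<nu> p + \<beta> *\<^sub>R m = 0 \<Longrightarrow> \<alpha> = 0 \<and> \<beta> = 0"
    and \<nu>: "\<nu> differentiable (at p)" and X: "X \<in> tangent_space M p"
  shows "tangent_to_principal_direction M \<nu> p X \<longleftrightarrow> wedge3 (connection p X \<nu>) X m \<bullet> \<nu> p = 0"
proof -
  define n where "n x = \<nu> x /\<^sub>R norm (\<nu> x)" for x
  define w where "w = connection p X n"
  define q where "q = wedge3 X m (\<nu> p)"
  \<comment> \<open>For \<open>X \<noteq> 0\<close> this is the orthogonal projection of
    \<open>w\<close> to the tangent plane, written in the orthogonal basis \<open>X\<close>,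
    \<open>q\<close>.\<close>
  define u where "u = ((w \<bullet> X) / (X \<bullet> X)) *\<^sub>R X + ((w \<bullet> q) / (q \<bullet> q)) *\<^sub>R q"
  have "\<nu> p \<noteq> 0" using indep[of 1 0] by auto
  have [simp]: "q \<bullet> X = 0" "X \<bullet> q = 0" "q \<bullet> \<nu> p = 0" "q \<bullet> m = 0" "X \<bullet> \<nu> p = 0" "X \<bullet> m = 0"
    using X T by (simp_all add: q_def inner_commute[of X])
  have "wedge3 (connection p X \<nu>) X m \<bullet> \<nu> p = - (connection p X \<nu> \<bullet> q)"
    unfolding q_def by (subst wedge3_rotate) (simp add: inner_commute)
  also have "\<dots> = - (norm (\<nu> p) * (w \<bullet> q))"
    using frechet_derivative_normalize_inner[OF \<nu> \<open>\<nu> p \<noteq> 0\<close>, of q X] \<open>\<nu> p \<noteq> 0\<close>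
    by (simp add: w_def n_def[abs_def] connection_def)
  finally have det_iff: "wedge3 (connection p X \<nu>) X m \<bullet> \<nu> p = 0 \<longleftrightarrow> w \<bullet> q = 0"
    using \<open>\<nu> p \<noteq> 0\<close> by simp
  show ?thesis
  proof (cases "X = 0")
    \<comment> \<open>The zero vector satisfies both sides: its shape operator value is zero, and so
      is \<open>q\<close>.\<close>
    case True
    have "linear (\<lambda>x. wedge3 x m (\<nu> p))" by (rule linear_wedge3)
    then have "q = 0" unfolding q_def True by (rule linear_0)
    have "n differentiable (at p)"
      unfolding n_def using \<nu> \<open>\<nu> p \<noteq> 0\<close>
      by (intro differentiable_scaleR differentiable_inverse differentiable_compose[of norm \<nu>])
        (simp_all add: differentiable_norm_at)
    then have "w = 0"
      unfolding w_def connection_def True by (simp add: linear_0 linear_frechet_derivative)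
    have "tangential_component M p 0 = 0"
      by (rule tangential_component_eqI) (auto simp: T subspace_def inner_add_left)
    then show ?thesis
      using X det_iff \<open>q = 0\<close> \<open>w = 0\<close>
      by (simp add: tangent_to_principal_direction_def shape_operator_def n_def[abs_def] w_def True)
  next
    case False
    have "q \<noteq> 0"
      unfolding q_def
    proof (rule wedge3_nonzero)
      fix \<alpha> \<beta> \<gamma> assume eq: "\<alpha> *\<^sub>R X + \<beta> *\<^sub>R m + \<gamma> *\<^sub>R \<nu> p = 0"
      then have "X \<bullet> (\<alpha> *\<^sub>R X + \<beta> *\<^sub>R m + \<gamma> *\<^sub>R \<nu> p) = 0" by simp
      then have "\<alpha> = 0" using False by (simp add: inner_add_right)
      with eq indep[of \<gamma> \<beta>] show "\<alpha> = 0 \<and> \<beta> = 0 \<and> \<gamma> = 0" by (simp add: add.commute)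
    qed
    have "(w - u) \<bullet> t = 0" if "t \<in> tangent_space M p" for t
    proof -
      \<comment> \<open>Removing the \<open>X\<close> part of \<open>t\<close> leaves a vector
        orthogonal to \<open>X\<close>, \<open>m\<close> and \<open>\<nu> p\<close>, hence a
        multiple of \<open>q\<close>. So \<open>X\<close> and \<open>q\<close> span the tangent
        plane.\<close>
      define s where "s = t - ((t \<bullet> X) / (X \<bullet> X)) *\<^sub>R X"
      have "s \<bullet> X = 0" "s \<bullet> m = 0" "s \<bullet> \<nu> p = 0"
        using that T False by (simp_all add: s_def inner_diff_left)
      then have s: "s = ((s \<bullet> q) / (q \<bullet> q)) *\<^sub>R q"
        using eq_scaleR_wedge3[of X m "\<nu> p" q s] \<open>q \<noteq> 0\<close> by (simp flip: q_def)
      have "(w - u) \<bullet> X = 0" "(w - u) \<bullet> q = 0"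
        using False \<open>q \<noteq> 0\<close> by (simp_all add: u_def inner_diff_left inner_add_left)
      moreover have "t = ((t \<bullet> X) / (X \<bullet> X)) *\<^sub>R X + ((s \<bullet> q) / (q \<bullet> q)) *\<^sub>R q"
        using s by (simp add: s_def)
      ultimately show ?thesis
        by (metis (no_types) add.right_neutral inner_add_right inner_scaleR_right mult_zero_right)
    qed
    then have u: "tangential_component M p w = u"
      by (intro tangential_component_eqI) (auto simp: T subspace_def inner_add_left u_def)
    \<comment> \<open>The shape operator sends \<open>X\<close> to \<open>- u\<close>, which is a
      multiple of \<open>X\<close> exactly when the \<open>q\<close> coefficient vanishes.\<close>
    have "(\<exists>l. - u = l *\<^sub>R X) \<longleftrightarrow> w \<bullet> q = 0"
    proof
      assume "\<exists>l. - u = l *\<^sub>R X"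
      then obtain l where "- u = l *\<^sub>R X" by blast
      then have "- u \<bullet> q = 0" by simp
      moreover have "u \<bullet> q = w \<bullet> q" using \<open>q \<noteq> 0\<close> by (simp add: u_def inner_add_left)
      ultimately show "w \<bullet> q = 0" by simp
    next
      assume "w \<bullet> q = 0"
      then show "\<exists>l. - u = l *\<^sub>R X"
        by (intro exI[of _ "- ((w \<bullet> X) / (X \<bullet> X))"]) (simp add: u_def)
    qed
    then show ?thesis
      using X det_iff u
      by (simp add: tangent_to_principal_direction_def shape_operator_def n_def[abs_def] w_def)
  qed
qed

theorem proposition2p3:
  fixes F G :: "real^4 \<Rightarrow> real" and a b :: real
    and M :: "(real^4) set" and \<nu> \<mu> :: "real^4 \<Rightarrow> real^4" and p X :: "real^4"
  assumes "smooth_on F UNIV" and "smooth_on G UNIV"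
    and "regular_value F a" and "regular_value G b"
    and "M = F -` {a} \<inter> G -` {b}"
    and "transversal (F -` {a}) (G -` {b})"
    and "\<And>x. GDERIV F x :> \<nu> x" and "\<And>x. GDERIV G x :> \<mu> x"
    and "p \<in> M" and "X \<in> tangent_space M p"
  shows "tangent_to_principal_direction M \<nu> p X \<longleftrightarrow> (X v* Omega \<nu> \<mu> p) \<bullet> X = 0"
proof -
  have Fp: "F p = a" and Gp: "G p = b" using assms(5,9) by auto
  have "\<nu> p \<noteq> 0" "\<mu> p \<noteq> 0"
    using gradient_nonzero_at_regular_value assms(3,4,7,8) Fp Gp by blast+
  then have indep: "\<alpha> = 0 \<and> \<beta> = 0" if "\<alpha> *\<^sub>R \<nu> p + \<beta> *\<^sub>R \<mu> p = 0" for \<alpha> \<beta>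
    using transversal_gradients_independent[OF assms(6) Fp Gp assms(7,8) _ _ that] by blast
  have "\<nu> differentiable (at p)"
    using smooth_on_differentiable[OF smooth_on_gradient[OF open_UNIV assms(1,7)]] by simp
  moreover have "tangent_space M p = {v. v \<bullet> \<nu> p = 0 \<and> v \<bullet> \<mu> p = 0}"
    unfolding assms(5) using tangent_space_level_sets[OF assms(1,2,7,8) Fp Gp indep] by blast
  ultimately show ?thesis
    using assms(10) by (simp add: tangent_to_principal_direction_iff indep Omega_quadratic_form)
qed

end
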